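(* For every $\eta>0$ and every sufficiently large integer constant $b$ (depending on $\eta$) there is a constant $C$ such that for every $k\ge 2$ the following holds. If $k$ stations execute the protocol SublinearDecrease$(b)$ and are activated by any adaptive adversary, then with probability at least $1-1/k^{\eta}$ the total number of broadcast attempts (transmissions, successful or not, by all stations together) during the execution is at most $C k\log^2 k$.
   Context: Model. $k$ anonymous identical stations share a channel. Time is divided into discrete synchronous rounds; there is no global clock available to the stations and no collision detection. Initially all stations are asleep. Each station holds one packet and is activated once, at a time chosen by an adversary. The activation round is round $0$ of the station's local clock, and the station may transmit from its local round $1$ on. In each round every active station either transmits or listens. A transmission is successful if and only if exactly one active station transmits in that round; the transmitter then receives an acknowledgement and switches off permanently. In all other cases nothing is received. The stations do not know $k$. An adaptive adversary decides online which station to activate and when, knowing the algorithm's code and the history of the computation but not future randomness; in total it activates $k$ stations. Protocol SublinearDecrease$(b)$ (executed by each station from its activation until it switches off): for $j=3,4,5,\ldots$: for $b$ rounds, transmit in each round with probability $\frac{\ln j}{j}$, independently over rounds and stations. *)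

theory Defs
  imports "HOL-Probability.Probability"
begin

text \<open>
  Stations are the numbers \<open>0, \<dots>, k - 1\<close>. A history lists the rounds so far in chronological order;
  the entry of a round is the pair (stations activated in it, stations transmitting in it).
  A round is successful iff its second component is a singleton.
\<close>

type_synonym history = "(nat set \<times> nat set) list"

text \<open>
  An adaptive adversary is a strategy: from the complete history of all earlier rounds (including
  who transmitted, successfully or not) it chooses the stations to activate in the current round.
\<close>

type_synonym adversary = "history \<Rightarrow> nat set"

definition activated :: "history \<Rightarrow> nat set" where
  "activated h = (\<Union>r\<in>set h. fst r)"

definition switched_off :: "history \<Rightarrow> nat set" where
  "switched_off h = {i. \<exists>r\<in>set h. snd r = {i}}"

definition active :: "history \<Rightarrow> nat set" where
  "active h = activated h - switched_off h"

definition activation_round :: "history \<Rightarrow> nat \<Rightarrow> nat" where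
  "activation_round h i = (LEAST t. t < length h \<and> i \<in> fst (h ! t))"

text \<open>
  Local clock of an activated station in the round following the history \<open>h\<close>, i.e. in global round
  \<open>length h\<close>; it is at least 1 for every station in \<open>activated h\<close>.
\<close>

definition local_round :: "history \<Rightarrow> nat \<Rightarrow> nat" where
  "local_round h i = length h - activation_round h i"

text \<open>
  The outcome \<open>\<omega> (i, m)\<close> says whether station \<open>i\<close>, if still active, transmits in its local round \<open>m\<close>.
  Each station is activated at most once: requests of the adversary for stations that are not
  asleep are void. A station activated in the current round does not yet transmit in it.
\<close>

definition next_round :: "nat \<Rightarrow> adversary \<Rightarrow> (nat \<times> nat \<Rightarrow> bool) \<Rightarrow> history \<Rightarrow> nat set \<times> nat set" where
  "next_round k A \<omega> h =
     ((A h \<inter> {..<k}) - activated h, {i \<in> active h. \<omega> (i, local_round h i)})"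

primrec run :: "nat \<Rightarrow> adversary \<Rightarrow> (nat \<times> nat \<Rightarrow> bool) \<Rightarrow> nat \<Rightarrow> history" where
  "run k A \<omega> 0 = []"
| "run k A \<omega> (Suc t) = run k A \<omega> t @ [next_round k A \<omega> (run k A \<omega> t)]"

definition transmitters :: "nat \<Rightarrow> adversary \<Rightarrow> (nat \<times> nat \<Rightarrow> bool) \<Rightarrow> nat \<Rightarrow> nat set" where
  "transmitters k A \<omega> t = snd (next_round k A \<omega> (run k A \<omega> t))"

text \<open>All broadcast attempts of the infinite execution, as pairs (round, transmitting station).\<close>

definition attempts :: "nat \<Rightarrow> adversary \<Rightarrow> (nat \<times> nat \<Rightarrow> bool) \<Rightarrow> (nat \<times> nat) set" where
  "attempts k A \<omega> = {(t, i). i \<in> transmitters k A \<omega> t}"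

text \<open>
  The local rounds \<open>1, \<dots>, b\<close> form the block \<open>j = 3\<close>, the next \<open>b\<close> rounds the block \<open>j = 4\<close>, and so on.
  Local round 0 is never used for transmitting, so the value there is irrelevant.
\<close>

definition sublinear_decrease :: "nat \<Rightarrow> nat \<Rightarrow> real" where
  "sublinear_decrease b m = (let j = real (3 + (m - 1) div b) in ln j / j)"

text \<open>Independent coins for all pairs (station, local round).\<close>

definition coins :: "(nat \<Rightarrow> real) \<Rightarrow> (nat \<times> nat \<Rightarrow> bool) measure" where
  "coins p = (\<Pi>\<^sub>M (i, m)\<in>UNIV. measure_pmf (bernoulli_pmf (p m)))"

text \<open>The adversary (almost surely) activates \<open>k\<close> stations in total.\<close>

definition activates_all :: "nat \<Rightarrow> (nat \<Rightarrow> real) \<Rightarrow> adversary \<Rightarrow> bool" where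
  "activates_all k p A \<longleftrightarrow> (AE \<omega> in coins p. \<forall>i<k. \<exists>t. i \<in> activated (run k A \<omega> t))"

end

theory Submission
  imports Defs
begin

text \<open>
  Fix a horizon of \<open>T = \<Theta>(b k\<^sup>2)\<close> local rounds. While a station is in its first \<open>T\<close> local rounds,
  the contention (the expected number of transmitters, given the history) adds up to at most \<open>k\<close> times
  the sum of \<open>p 1, \<dots>, p T\<close>, whatever the adversary does, because \<open>p\<close> is decreasing; this is at most
  \<open>T / 2\<close>. Given the history, the station transmits alone with probability at least
  \<open>p T * (1 - contention)\<close>, so an exponential supermartingale shows that it outlives its local round \<open>T\<close>
  with probability at most \<open>exp (- p T * T / 2)\<close>, a power of \<open>1 / k\<close> whose exponent grows with \<open>b\<close>.
  If no station does, every attempt uses one of the coins \<open>(i, m)\<close> with \<open>i < k\<close> and \<open>1 \<le> m \<le> T\<close>, and a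
  Chernoff bound for these independent coins, whose means sum to \<open>O(k log\<^sup>2 k)\<close>, finishes the proof.
\<close>

section \<open>Finitely many coins\<close>

lemma space_coins [simp]: "space (coins p) = UNIV"
  by (auto simp: coins_def space_PiM)

lemma prob_space_coins: "prob_space (coins p)"
  unfolding coins_def by (rule prob_space_PiM) (auto intro: measure_pmf.prob_space_axioms)

lemma cylinder_in_sets_coins:
  assumes "finite D"
  shows "{\<omega>. \<forall>x\<in>D. \<omega> x = v x} \<in> sets (coins p)"
proof -
  have "{\<omega>. \<omega> x = v x} \<in> sets (coins p)" for x
  proof -
    have "(\<lambda>\<omega>. \<omega> x) \<in> measurable (coins p) (measure_pmf (bernoulli_pmf (p (snd x))))"
      unfolding coins_def using measurable_component_singleton[of x UNIV
        "\<lambda>(i, m). measure_pmf (bernoulli_pmf (p m))"] by (simp add: case_prod_unfold)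
    from measurable_sets[OF this, of "{v x}"] show ?thesis
      by (simp add: vimage_def)
  qed
  then have "(\<Inter>x\<in>D. {\<omega>. \<omega> x = v x}) \<in> sets (coins p)" if "D \<noteq> {}"
    using that assms by (intro sets.finite_INT) auto
  moreover have "(\<Inter>x\<in>D. {\<omega>. \<omega> x = v x}) = {\<omega>. \<forall>x\<in>D. \<omega> x = v x}"
    by auto
  ultimately show ?thesis
    using sets.top[of "coins p"] by (cases "D = {}") auto
qed

lemma measure_cylinder:
  assumes "finite D"
  shows "measure (coins p) {\<omega>. \<forall>x\<in>D. \<omega> x = v x} = (\<Prod>x\<in>D. pmf (bernoulli_pmf (p (snd x))) (v x))"
proof -
  interpret product_prob_space "\<lambda>(i, m). measure_pmf (bernoulli_pmf (p m))" "UNIV :: (nat \<times> nat) set"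
    by (intro product_prob_spaceI) (auto split: prod.splits intro: measure_pmf.prob_space_axioms)
  have "emeasure (coins p) {\<omega>. \<forall>x\<in>D. \<omega> x = v x} =
        (\<Prod>x\<in>D. emeasure (measure_pmf (bernoulli_pmf (p (snd x)))) {v x})"
    using emeasure_PiM_Collect[of D "\<lambda>x. {v x}"] assms space_coins[of p]
    by (simp add: coins_def case_prod_unfold)
  also have "\<dots> = ennreal (\<Prod>x\<in>D. pmf (bernoulli_pmf (p (snd x))) (v x))"
    by (simp add: emeasure_pmf_single prod_ennreal)
  finally show ?thesis
    by (simp add: measure_def prod_nonneg)
qed

section \<open>The execution\<close>

lemma length_run [simp]: "length (run k A \<omega> t) = t"
  by (induction t) auto

lemma take_run: "s \<le> t \<Longrightarrow> take s (run k A \<omega> t) = run k A \<omega> s"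
  by (induction t) (auto simp: le_Suc_eq)

lemma nth_run: "s < t \<Longrightarrow> run k A \<omega> t ! s = next_round k A \<omega> (run k A \<omega> s)"
  by (induction t) (auto simp: less_Suc_eq nth_append)

lemma activated_append: "activated (h @ g) = activated h \<union> activated g"
  by (auto simp: activated_def)

lemma activated_run: "activated (run k A \<omega> t) \<subseteq> {..<k}"
  by (induction t) (auto simp: activated_def next_round_def)

lemma active_run: "active (run k A \<omega> t) \<subseteq> {..<k}"
  using activated_run[of k A \<omega> t] by (auto simp: active_def)

lemma activation_round_spec:
  assumes "i \<in> activated h"
  shows "activation_round h i < length h" and "i \<in> fst (h ! activation_round h i)"
proof -
  have "\<exists>t. t < length h \<and> i \<in> fst (h ! t)"
    using assms unfolding activated_def by (metis UN_E in_set_conv_nth)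
  then have "activation_round h i < length h \<and> i \<in> fst (h ! activation_round h i)"
    unfolding activation_round_def by (rule LeastI_ex)
  then show "activation_round h i < length h" and "i \<in> fst (h ! activation_round h i)"
    by auto
qed

text \<open>Lets clocks be compared between a history and its prefixes. The hypothesis is essential:
  for a station still asleep in \<open>h\<close>, the \<open>LEAST\<close> ranges over an empty
  predicate and is an arbitrary number.\<close>

lemma activation_round_append:
  assumes "i \<in> activated h"
  shows "activation_round (h @ g) i = activation_round h i"
  unfolding activation_round_def[of "h @ g"]
proof (rule Least_equality)
  show "activation_round h i < length (h @ g) \<and> i \<in> fst ((h @ g) ! activation_round h i)"
    using activation_round_spec[OF assms] by (auto simp: nth_append)
  fix t assume t: "t < length (h @ g) \<and> i \<in> fst ((h @ g) ! t)"
  show "activation_round h i \<le> t"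
  proof (cases "t < length h")
    case True
    then show ?thesis
      using t unfolding activation_round_def by (intro Least_le) (auto simp: nth_append)
  qed (use activation_round_spec(1)[OF assms] in simp)
qed

lemma activation_round_take:
  assumes "i \<in> activated (take s h)"
  shows "activation_round (take s h) i = activation_round h i"
  using activation_round_append[OF assms, of "drop s h"] by simp

lemma activated_take:
  assumes "i \<in> activated h" "activation_round h i < s"
  shows "i \<in> activated (take s h)"
proof -
  have "take s h ! activation_round h i = h ! activation_round h i"
    using assms by simp
  then show ?thesis
    using activation_round_spec[OF assms(1)] assms(2) unfolding activated_def
    by (metis UN_I length_take min_less_iff_conj nth_mem)
qed

text \<open>A success recorded in a prefix stays recorded in every extension, so switching off is
  permanent and activity carries back to every prefix that contains the activation.\<close>

lemma active_take:
  assumes "i \<in> active h" "activation_round h i < s"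
  shows "i \<in> active (take s h)"
  using assms activated_take[of i h s] by (auto simp: active_def switched_off_def dest: in_set_takeD)

text \<open>
  The coins that determine a history: an event \<open>run k A \<omega> t = h\<close> is empty or a cylinder over the
  coordinates \<open>seen h\<close>, and the coins of the next round are not among them.
\<close>

definition seen :: "history \<Rightarrow> (nat \<times> nat) set" where
  "seen h = {(j, m). \<exists>s<length h. j \<in> active (take s h) \<and> m = local_round (take s h) j}"

lemma seen_snoc: "seen (h @ [r]) = seen h \<union> (\<lambda>j. (j, local_round h j)) ` active h"
  by (auto simp: seen_def less_Suc_eq)

lemma finite_seen_run: "finite (seen (run k A \<omega> t))"
proof (induction t)
  case (Suc t)
  then show ?case
    using finite_subset[OF active_run, of k A \<omega> t] by (simp add: seen_snoc)
qed (simp add: seen_def)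

text \<open>The activation round stays fixed while the history grows, so a station's clock strictly
  increases and never points to the same coin twice. This makes the next round's coins independent
  of the past.\<close>

lemma fresh_coin:
  assumes "j \<in> active h"
  shows "(j, local_round h j) \<notin> seen h"
proof
  assume "(j, local_round h j) \<in> seen h"
  then obtain s where s: "s < length h" "j \<in> active (take s h)" "local_round h j = local_round (take s h) j"
    by (auto simp: seen_def)
  have "activation_round (take s h) j < s"
    using activation_round_spec(1)[of j "take s h"] s by (auto simp: active_def)
  then show False
    using s activation_round_take[of j s h] by (auto simp: local_round_def active_def)
qed

text \<open>The adversary is a deterministic function of the history. Hence outcomes with a common
  history have the same activations and clocks in the next round, and their transmitter sets agree
  exactly when the coins of the active stations do.\<close>

lemma run_eq_iff:
  "run k A \<omega>' t = run k A \<omega> t \<longleftrightarrow> (\<forall>x\<in>seen (run k A \<omega> t). \<omega>' x = \<omega> x)"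
proof (induction t)
  case (Suc t)
  have "next_round k A \<omega>' h = next_round k A \<omega> h \<longleftrightarrow>
        (\<forall>x\<in>(\<lambda>j. (j, local_round h j)) ` active h. \<omega>' x = \<omega> x)" for h
    by (auto simp: next_round_def)
  then have "run k A \<omega>' (Suc t) = run k A \<omega> (Suc t) \<longleftrightarrow>
    run k A \<omega>' t = run k A \<omega> t \<and>
    (\<forall>x\<in>(\<lambda>j. (j, local_round (run k A \<omega> t) j)) ` active (run k A \<omega> t). \<omega>' x = \<omega> x)"
    by (simp del: ball_simps cong: conj_cong)
  also have "\<dots> \<longleftrightarrow> (\<forall>x\<in>seen (run k A \<omega> (Suc t)). \<omega>' x = \<omega> x)"
    unfolding Suc run.simps seen_snoc ball_Un ..
  finally show ?case .
qed (simp add: seen_def)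

section \<open>Events and expectations determined by finitely many rounds\<close>

definition histories :: "nat \<Rightarrow> nat \<Rightarrow> history set" where
  "histories k t = {h. set h \<subseteq> Pow {..<k} \<times> Pow {..<k} \<and> length h = t}"

lemma finite_histories [simp]: "finite (histories k t)"
  unfolding histories_def by (rule finite_lists_length_eq) simp

lemma run_in_histories: "run k A \<omega> t \<in> histories k t"
proof (induction t)
  case (Suc t)
  have "next_round k A \<omega> (run k A \<omega> t) \<in> Pow {..<k} \<times> Pow {..<k}"
    using active_run[of k A \<omega> t] by (auto simp: next_round_def)
  with Suc show ?case by (simp add: histories_def)
qed (simp add: histories_def)

lemma run_eq_in_sets_coins: "{\<omega>. run k A \<omega> t = h} \<in> sets (coins p)"
proof (cases "\<exists>\<omega>0. run k A \<omega>0 t = h")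
  case True
  then obtain \<omega>0 where "h = run k A \<omega>0 t"
    by auto
  then show ?thesis
    by (simp add: run_eq_iff cylinder_in_sets_coins finite_seen_run)
qed simp

lemma run_Collect_in_sets_coins: "{\<omega>. P (run k A \<omega> t)} \<in> sets (coins p)"
proof -
  have "{\<omega>. P (run k A \<omega> t)} = (\<Union>h\<in>{h \<in> histories k t. P h}. {\<omega>. run k A \<omega> t = h})"
    using run_in_histories by auto
  also have "\<dots> \<in> sets (coins p)"
    by (intro sets.finite_UN) (auto simp: run_eq_in_sets_coins)
  finally show ?thesis .
qed

lemma expectation_run:
  fixes f :: "history \<Rightarrow> real"
  shows "integrable (coins p) (\<lambda>\<omega>. f (run k A \<omega> t))"
    and "(\<integral>\<omega>. f (run k A \<omega> t) \<partial>coins p) =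
         (\<Sum>h\<in>histories k t. f h * measure (coins p) {\<omega>. run k A \<omega> t = h})"
proof -
  interpret prob_space "coins p" by (rule prob_space_coins)
  have eq: "f (run k A \<omega> t) = (\<Sum>h\<in>histories k t. f h * indicator {\<omega>. run k A \<omega> t = h} \<omega>)" for \<omega>
    using run_in_histories[of k A \<omega> t] by (simp add: indicator_def if_distrib cong: if_cong)
  have int: "integrable (coins p) (\<lambda>\<omega>. f h * indicator {\<omega>. run k A \<omega> t = h} \<omega>)" for h
    by (intro integrable_mult_right integrable_real_indicator) (auto simp: run_eq_in_sets_coins emeasure_eq_measure)
  show "integrable (coins p) (\<lambda>\<omega>. f (run k A \<omega> t))"
    unfolding eq by (intro Bochner_Integration.integrable_sum int)
  show "(\<integral>\<omega>. f (run k A \<omega> t) \<partial>coins p) =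
         (\<Sum>h\<in>histories k t. f h * measure (coins p) {\<omega>. run k A \<omega> t = h})"
    unfolding eq by (subst Bochner_Integration.integral_sum) (simp_all only: int Bochner_Integration.integral_mult_right_zero, simp)
qed

definition contention :: "(nat \<Rightarrow> real) \<Rightarrow> history \<Rightarrow> real" where
  "contention p h = (\<Sum>j\<in>active h. p (local_round h j))"

text \<open>The coins of the active stations are fresh, so the joint event is a cylinder over
  \<open>seen h\<close> and these coins, and its measure factors. The probability that only
  \<open>i\<close> transmits is its own \<open>p\<close> times the product of \<open>1 - p\<close>
  over the other active stations; Weierstrass' inequality bounds that product from below by one
  minus a sum.\<close>

lemma solo_probability:
  assumes p: "\<And>m. 0 \<le> p m" "\<And>m. p m \<le> 1"
    and i: "i \<in> active h"
  shows "measure (coins p) {\<omega>. run k A \<omega> t = h \<and> snd (next_round k A \<omega> h) = {i}} \<ge>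
         measure (coins p) {\<omega>. run k A \<omega> t = h} * (p (local_round h i) * (1 - contention p h))"
proof (cases "\<exists>\<omega>0. run k A \<omega>0 t = h")
  case True
  then obtain \<omega>0 where \<omega>0: "run k A \<omega>0 t = h" ..
  define E where "E = (\<lambda>j. (j, local_round h j)) ` active h"
  \<comment> \<open>The cylinder's prescribed values: the past as in the reference outcome, and on
    the fresh coins heads for station \<open>i\<close> only.\<close>
  define v where "v = (\<lambda>x. if x \<in> seen h then \<omega>0 x else fst x = i)"
  define q where "q = (\<lambda>v (x :: nat \<times> nat). pmf (bernoulli_pmf (p (snd x))) (v x))"
  have fin: "finite (active h)" "finite (seen h)"
    using finite_subset[OF active_run[of k A \<omega>0 t]] finite_seen_run[of k A \<omega>0 t] \<omega>0 by auto
  have finE: "finite E" and disj: "seen h \<inter> E = {}"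
    using fin fresh_coin by (auto simp: E_def)
  have run: "run k A \<omega> t = h \<longleftrightarrow> (\<forall>x\<in>seen h. \<omega> x = \<omega>0 x)" for \<omega>
    using run_eq_iff[of k A \<omega> t \<omega>0] \<omega>0 by simp
  have nxt: "snd (next_round k A \<omega> h) = {i} \<longleftrightarrow> (\<forall>x\<in>E. \<omega> x = v x)" for \<omega>
    using i disj by (auto simp: next_round_def E_def v_def)
  have "{\<omega>. run k A \<omega> t = h \<and> snd (next_round k A \<omega> h) = {i}} = {\<omega>. \<forall>x\<in>seen h \<union> E. \<omega> x = v x}"
    unfolding run nxt by (auto simp: v_def)
  then have "measure (coins p) {\<omega>. run k A \<omega> t = h \<and> snd (next_round k A \<omega> h) = {i}} =
             (\<Prod>x\<in>seen h. q v x) * (\<Prod>x\<in>E. q v x)"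
    using measure_cylinder[of "seen h \<union> E" p v] fin finE disj
    by (simp add: prod.union_disjoint q_def)
  also have "(\<Prod>x\<in>seen h. q v x) = measure (coins p) {\<omega>. run k A \<omega> t = h}"
    unfolding run using measure_cylinder[of "seen h" p \<omega>0] fin by (simp add: q_def v_def)
  also have "(\<Prod>x\<in>E. q v x) = (\<Prod>j\<in>active h. q v (j, local_round h j))"
    unfolding E_def by (subst prod.reindex) (auto simp: inj_on_def)
  also have "\<dots> = (\<Prod>j\<in>active h. if j = i then p (local_round h j) else 1 - p (local_round h j))"
    using p fresh_coin by (intro prod.cong) (auto simp: q_def v_def)
  also have "\<dots> = p (local_round h i) * (\<Prod>j\<in>active h - {i}. 1 - p (local_round h j))"
    using fin i by (subst prod.remove[of _ i]) (auto intro!: prod.cong)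
  finally have eq: "measure (coins p) {\<omega>. run k A \<omega> t = h \<and> snd (next_round k A \<omega> h) = {i}} =
    measure (coins p) {\<omega>. run k A \<omega> t = h} *
      (p (local_round h i) * (\<Prod>j\<in>active h - {i}. 1 - p (local_round h j)))" .
  have "1 - contention p h \<le> 1 - (\<Sum>j\<in>active h - {i}. p (local_round h j))"
    unfolding contention_def using fin p by (auto intro!: sum_mono2)
  also have "\<dots> \<le> (\<Prod>j\<in>active h - {i}. 1 - p (local_round h j))"
    using p by (intro Weierstrass_prod_ineq) auto
  finally show ?thesis
    unfolding eq using p by (intro mult_left_mono) auto
next
  case False
  then show ?thesis by simp
qed

section \<open>Survival of a single station\<close>

text \<open>
  The product \<open>weight\<close> of these factors is the supermartingale. Its exponents use \<open>p T\<close>, the least transmission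
  probability of the first \<open>T\<close> local rounds, and may be negative, so rounds of high contention need no
  separate treatment.
\<close>

definition weight_factor :: "(nat \<Rightarrow> real) \<Rightarrow> nat \<Rightarrow> nat \<Rightarrow> history \<Rightarrow> nat set \<times> nat set \<Rightarrow> real" where
  "weight_factor p T i h r =
     (if i \<in> active h \<and> local_round h i \<le> T
      then (if snd r = {i} then 0 else exp (p T * (1 - contention p h))) else 1)"

definition weight :: "(nat \<Rightarrow> real) \<Rightarrow> nat \<Rightarrow> nat \<Rightarrow> history \<Rightarrow> real" where
  "weight p T i h = (\<Prod>s<length h. weight_factor p T i (take s h) (h ! s))"

lemma weight_nonneg: "0 \<le> weight p T i h"
  by (auto simp: weight_def weight_factor_def intro!: prod_nonneg)

lemma weight_snoc: "weight p T i (h @ [r]) = weight p T i h * weight_factor p T i h r"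
  by (simp add: weight_def nth_append)

lemma local_round_pos: "i \<in> active h \<Longrightarrow> 0 < local_round h i"
  using activation_round_spec(1)[of i h] by (auto simp: active_def local_round_def)

lemma exp_mult_le: "d \<le> r * exp (- x) \<Longrightarrow> exp x * d \<le> r" for x :: real
  by (simp add: exp_minus field_simps)

text \<open>One step of the supermartingale property, in unnormalised form: \<open>f\<close>
  vanishes unless the first \<open>t\<close> rounds are \<open>h\<close>, so no conditional
  expectation is needed. With \<open>x = p T * (1 - \<sigma>)\<close>, a solo success has
  conditional probability at least \<open>x\<close> when \<open>\<sigma>\<close> is at most 1, and
  \<open>exp x * (1 - x)\<close> never exceeds 1.\<close>

lemma weight_factor_expectation:
  fixes T i t :: nat
  assumes p: "\<And>m. 0 \<le> p m" "\<And>m. p m \<le> 1"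
    and anti: "\<And>m n. 0 < m \<Longrightarrow> m \<le> n \<Longrightarrow> p n \<le> p m"
  defines "f \<equiv> \<lambda>h' h. if take t h' = h then weight_factor p T i h (h' ! t) else 0"
  shows "(\<integral>\<omega>. f (run k A \<omega> (Suc t)) h \<partial>coins p) \<le> measure (coins p) {\<omega>. run k A \<omega> t = h}"
proof (cases "i \<in> active h \<and> local_round h i \<le> T")
  case False
  have "f (run k A \<omega> (Suc t)) h = indicator {\<omega>. run k A \<omega> t = h} \<omega>" for \<omega>
    using False by (auto simp: f_def weight_factor_def)
  then show ?thesis by simp
next
  case True
  interpret prob_space "coins p" by (rule prob_space_coins)
  define \<sigma> where "\<sigma> = contention p h"
  let ?R = "{\<omega>. run k A \<omega> t = h}"
  let ?S = "{\<omega>. run k A \<omega> t = h \<and> snd (next_round k A \<omega> h) = {i}}"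
  have last: "take t (run k A \<omega> (Suc t)) = run k A \<omega> t"
      "run k A \<omega> (Suc t) ! t = next_round k A \<omega> (run k A \<omega> t)" for \<omega>
    by (simp_all add: nth_append)
  have "?S = {\<omega>. run k A \<omega> t = h \<and> snd (next_round k A \<omega> (run k A \<omega> t)) = {i}}"
    by (intro Collect_cong conj_cong refl) simp
  then have S: "?S \<in> sets (coins p)"
    using run_Collect_in_sets_coins[of "\<lambda>h'. take t h' = h \<and> snd (h' ! t) = {i}" k A "Suc t" p]
    unfolding last by argo
  have int: "integrable (coins p) (indicator ?R :: _ \<Rightarrow> real)" "integrable (coins p) (indicator ?S :: _ \<Rightarrow> real)"
    using S run_eq_in_sets_coins by (auto simp: emeasure_eq_measure intro!: integrable_real_indicator)
  have "f (run k A \<omega> (Suc t)) h = exp (p T * (1 - \<sigma>)) * (indicator ?R \<omega> - indicator ?S \<omega>)" for \<omega>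
    unfolding f_def last using True
    by (cases "run k A \<omega> t = h") (simp_all add: weight_factor_def \<sigma>_def)
  then have "(\<integral>\<omega>. f (run k A \<omega> (Suc t)) h \<partial>coins p) =
             exp (p T * (1 - \<sigma>)) * (measure (coins p) ?R - measure (coins p) ?S)"
    using int by (simp add: Bochner_Integration.integral_diff)
  also have "\<dots> \<le> measure (coins p) ?R"
  proof (cases "\<sigma> \<le> 1")
    case le: True
    \<comment> \<open>Replacing the current probability by the smaller \<open>p T\<close> relies on
      \<open>1 - \<sigma>\<close> being nonnegative.\<close>
    have "p T * (1 - \<sigma>) \<le> p (local_round h i) * (1 - \<sigma>)"
      using le True local_round_pos[of i h] by (intro mult_right_mono anti) auto
    then have "measure (coins p) ?R * (p T * (1 - \<sigma>)) \<le>
        measure (coins p) ?R * (p (local_round h i) * (1 - \<sigma>))"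
      by (rule mult_left_mono) simp
    also have "\<dots> \<le> measure (coins p) ?S"
      unfolding \<sigma>_def using True by (intro solo_probability p) simp
    finally have "measure (coins p) ?R * (p T * (1 - \<sigma>)) \<le> measure (coins p) ?S" .
    then have "measure (coins p) ?R - measure (coins p) ?S \<le> measure (coins p) ?R * (1 - p T * (1 - \<sigma>))"
      by (simp add: algebra_simps)
    also have "\<dots> \<le> measure (coins p) ?R * exp (- (p T * (1 - \<sigma>)))"
      using exp_ge_add_one_self[of "- (p T * (1 - \<sigma>))"] by (intro mult_left_mono) auto
    finally show ?thesis
      by (rule exp_mult_le)
  next
    \<comment> \<open>Under high contention the exponent is nonpositive, so the factor is at most 1
      and no lower bound on the success probability is required.\<close>
    case False
    then have "exp (p T * (1 - \<sigma>)) \<le> 1"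
      using p(1)[of T] by (simp add: mult_nonneg_nonpos)
    moreover have "measure (coins p) ?S \<le> measure (coins p) ?R"
      using run_eq_in_sets_coins by (intro finite_measure_mono) auto
    ultimately have "exp (p T * (1 - \<sigma>)) * (measure (coins p) ?R - measure (coins p) ?S) \<le>
        1 * (measure (coins p) ?R - measure (coins p) ?S)"
      by (intro mult_right_mono) auto
    also have "\<dots> \<le> measure (coins p) ?R"
      by simp
    finally show ?thesis .
  qed
  finally show ?thesis .
qed

text \<open>Total expectation over the finitely many histories of length \<open>t\<close>: on each
  of them the past weight is a constant, and the one-step bound applies to the new factor.\<close>

lemma weight_expectation:
  assumes p: "\<And>m. 0 \<le> p m" "\<And>m. p m \<le> 1"
    and anti: "\<And>m n. 0 < m \<Longrightarrow> m \<le> n \<Longrightarrow> p n \<le> p m"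
  shows "(\<integral>\<omega>. weight p T i (run k A \<omega> t) \<partial>coins p) \<le> 1"
proof (induction t)
  case 0
  interpret prob_space "coins p" by (rule prob_space_coins)
  show ?case using prob_space by (simp add: weight_def)
next
  case (Suc t)
  define f where "f = (\<lambda>h' h. if take t h' = h then weight_factor p T i h (h' ! t) else 0)"
  have split: "weight p T i (run k A \<omega> (Suc t)) =
    (\<Sum>h\<in>histories k t. weight p T i h * f (run k A \<omega> (Suc t)) h)" for \<omega>
  proof -
    have "(\<Sum>h\<in>histories k t. weight p T i h * f (run k A \<omega> (Suc t)) h) =
      (\<Sum>h\<in>histories k t. if h = run k A \<omega> t
        then weight p T i h * weight_factor p T i h (next_round k A \<omega> (run k A \<omega> t)) else 0)"
      by (intro sum.cong) (auto simp: f_def nth_append)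
    then show ?thesis
      using run_in_histories[of k A \<omega> t] by (simp add: weight_snoc)
  qed
  have "(\<integral>\<omega>. weight p T i (run k A \<omega> (Suc t)) \<partial>coins p) =
        (\<Sum>h\<in>histories k t. weight p T i h * (\<integral>\<omega>. f (run k A \<omega> (Suc t)) h \<partial>coins p))"
    unfolding split using expectation_run(1)[of p "\<lambda>h'. f h' _" k A "Suc t"]
    by (subst Bochner_Integration.integral_sum) (auto simp del: run.simps)
  also have "\<dots> \<le> (\<Sum>h\<in>histories k t. weight p T i h * measure (coins p) {\<omega>. run k A \<omega> t = h})"
    unfolding f_def
    by (intro sum_mono mult_left_mono weight_factor_expectation assms weight_nonneg)
  also have "\<dots> \<le> 1"
    using Suc by (simp add: expectation_run(2))
  finally show ?case .
qed

text \<open>Such a station was active without success in each of its local rounds 1 to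
  \<open>T\<close>, so these rounds contribute exactly \<open>T\<close> exponential factors. Every
  other round contributes 1, including those after \<open>s\<close>, whatever happens there.\<close>

lemma weight_overdue:
  assumes i: "i \<in> active (take s h)" "local_round (take s h) i > T" and s: "s \<le> length h"
  shows "weight p T i h =
    exp (p T * (real T - (\<Sum>m=1..T. contention p (take (activation_round h i + m) h))))"
proof -
  define a where "a = activation_round h i"
  have act: "i \<in> activated h"
    using i(1) activated_append[of "take s h" "drop s h"] by (auto simp: active_def)
  have a: "activation_round (take s h) i = a"
    using i(1) by (auto simp: a_def active_def activation_round_take)
  have as: "a + T < s"
    using i(2) s a by (simp add: local_round_def)
  \<comment> \<open>The case \<open>u = a\<close> counts: the prefix of length \<open>a\<close>
    excludes the activation round itself, so local round 0 contributes a factor 1.\<close>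
  have not_yet: "i \<notin> activated (take u h)" if "u \<le> a" for u
    using that activation_round_take[of i u h] activation_round_spec(1)[of i "take u h"]
    by (auto simp: a_def)
  have clock: "local_round (take u h) i = u - a" if "a < u" "u \<le> length h" for u
    using that activated_take[OF act] activation_round_take[of i u h] by (auto simp: a_def local_round_def)
  have alive: "i \<in> active (take u h)" if "a < u" "u \<le> s" for u
    using that active_take[OF i(1), of u] by (simp add: a min_def split: if_splits)
  have fail: "snd (h ! u) \<noteq> {i}" if "u < s" for u
  proof
    assume "snd (h ! u) = {i}"
    moreover have "h ! u \<in> set (take s h)"
      using that s by (force simp: in_set_conv_nth)
    ultimately show False
      using i(1) by (auto simp: active_def switched_off_def)
  qed
  have "weight p T i h = (\<Prod>u\<in>(\<lambda>m. a + m) ` {1..T}. weight_factor p T i (take u h) (h ! u))"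
    unfolding weight_def
  proof (rule prod.mono_neutral_right)
    show "(\<lambda>m. a + m) ` {1..T} \<subseteq> {..<length h}"
      using as s by auto
    show "\<forall>u\<in>{..<length h} - (\<lambda>m. a + m) ` {1..T}. weight_factor p T i (take u h) (h ! u) = 1"
    proof
      fix u assume u: "u \<in> {..<length h} - (\<lambda>m. a + m) ` {1..T}"
      have "u \<le> a \<or> a + T < u"
        using u by (force simp: image_iff dest: le_Suc_ex)
      then show "weight_factor p T i (take u h) (h ! u) = 1"
        using u not_yet[of u] clock[of u] by (auto simp: weight_factor_def active_def)
    qed
  qed simp
  also have "\<dots> = (\<Prod>m\<in>{1..T}. exp (p T * (1 - contention p (take (a + m) h))))"
    using as s by (subst prod.reindex) (auto simp: weight_factor_def alive clock fail intro!: prod.cong)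
  also have "\<dots> = exp (\<Sum>m=1..T. p T * (1 - contention p (take (a + m) h)))"
    by (simp add: exp_sum)
  also have "\<dots> = exp (p T * (real T - (\<Sum>m=1..T. contention p (take (a + m) h))))"
    by (simp add: sum_distrib_left[symmetric] sum_subtractf)
  finally show ?thesis
    by (simp add: a_def)
qed

text \<open>The load of a station activated in round \<open>c\<close> on the window
  \<open>a + 1\<close> to \<open>a + T\<close>. If \<open>c\<close> is at most \<open>a\<close>, its
  clock in round \<open>a + m\<close> is at least \<open>m\<close>, and the bound holds termwise.
  Otherwise its clock takes distinct values in 1 to \<open>T\<close>, giving a subsum.\<close>

lemma sum_shift_antimono:
  fixes p :: "nat \<Rightarrow> real"
  assumes p: "\<And>m. 0 \<le> p m" and anti: "\<And>m n. 0 < m \<Longrightarrow> m \<le> n \<Longrightarrow> p n \<le> p m"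
  shows "(\<Sum>m=1..T. if c < a + m then p (a + m - c) else 0) \<le> (\<Sum>m=1..T. p m)"
proof (cases "c \<le> a")
  case True
  then show ?thesis
    using p by (intro sum_mono) (auto intro!: anti)
next
  case False
  have "(\<Sum>m=1..T. if c < a + m then p (a + m - c) else 0) =
        (\<Sum>m\<in>{m \<in> {1..T}. c < a + m}. p (a + m - c))"
    by (rule sum.inter_filter[symmetric]) simp
  also have "\<dots> = sum p ((\<lambda>m. a + m - c) ` {m \<in> {1..T}. c < a + m})"
    by (subst sum.reindex) (auto simp: inj_on_def)
  also have "\<dots> \<le> sum p {1..T}"
    using False p by (intro sum_mono2) auto
  finally show ?thesis .
qed

text \<open>Exchanging the sums turns the contention over a window into the separate loads of the
  stations, each at most the sum of \<open>p\<close> over the first \<open>T\<close> local rounds,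
  whichever activation times the adversary picks.\<close>

lemma sum_contention_le:
  assumes p: "\<And>m. 0 \<le> p m" and anti: "\<And>m n. 0 < m \<Longrightarrow> m \<le> n \<Longrightarrow> p n \<le> p m"
    and k: "activated h \<subseteq> {..<k}" and len: "a + T \<le> length h"
  shows "(\<Sum>m=1..T. contention p (take (a + m) h)) \<le> real k * (\<Sum>m=1..T. p m)"
proof -
  have "contention p (take s h) \<le>
        (\<Sum>j<k. if activation_round h j < s then p (s - activation_round h j) else 0)" if "s \<le> length h" for s
  proof -
    have sub: "activated (take s h) \<subseteq> activated h"
      by (auto simp: activated_def dest: in_set_takeD)
    have *: "activation_round h j < s" "local_round (take s h) j = s - activation_round h j"
      if "j \<in> active (take s h)" for j
      using that \<open>s \<le> length h\<close> activation_round_take[of j s h] activation_round_spec(1)[of j "take s h"]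
      by (auto simp: active_def local_round_def)
    have "contention p (take s h) =
        (\<Sum>j\<in>active (take s h). if activation_round h j < s then p (s - activation_round h j) else 0)"
      unfolding contention_def by (intro sum.cong) (auto simp: *)
    \<comment> \<open>For a station never activated, \<open>activation_round\<close> is an arbitrary
      number; its term is harmless because it is nonnegative.\<close>
    also have "\<dots> \<le> (\<Sum>j<k. if activation_round h j < s then p (s - activation_round h j) else 0)"
      using p sub k by (intro sum_mono2) (auto simp: active_def)
    finally show ?thesis .
  qed
  then have "(\<Sum>m=1..T. contention p (take (a + m) h)) \<le>
    (\<Sum>m=1..T. \<Sum>j<k. if activation_round h j < a + m then p (a + m - activation_round h j) else 0)"
    using len by (intro sum_mono) auto
  also have "\<dots> = (\<Sum>j<k. \<Sum>m=1..T. if activation_round h j < a + m then p (a + m - activation_round h j) else 0)"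
    by (rule sum.swap)
  also have "\<dots> \<le> (\<Sum>j<k. \<Sum>m=1..T. p m)"
    by (intro sum_mono sum_shift_antimono assms)
  finally show ?thesis by simp
qed

text \<open>Quantifying over prefixes makes the property persist even if the station succeeds
  later.\<close>

definition overdue :: "nat \<Rightarrow> nat \<Rightarrow> history \<Rightarrow> bool" where
  "overdue T i h \<longleftrightarrow> (\<exists>s\<le>length h. i \<in> active (take s h) \<and> local_round (take s h) i > T)"

text \<open>Markov's inequality: on this event the weight is at least \<open>c\<close>, by the
  contention bound, while its mean is at most 1.\<close>

lemma overdue_probability:
  assumes p: "\<And>m. 0 \<le> p m" "\<And>m. p m \<le> 1"
    and anti: "\<And>m n. 0 < m \<Longrightarrow> m \<le> n \<Longrightarrow> p n \<le> p m"
  shows "measure (coins p) {\<omega>. overdue T i (run k A \<omega> t)} \<le>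
         exp (- (p T * (real T - real k * (\<Sum>m=1..T. p m))))"
proof -
  interpret prob_space "coins p" by (rule prob_space_coins)
  define c where "c = exp (p T * (real T - real k * (\<Sum>m=1..T. p m)))"
  have "c \<le> weight p T i (run k A \<omega> t)" if "overdue T i (run k A \<omega> t)" for \<omega>
  proof -
    define h where "h = run k A \<omega> t"
    obtain s where s: "s \<le> length h" "i \<in> active (take s h)" "local_round (take s h) i > T"
      using \<open>overdue T i (run k A \<omega> t)\<close> by (auto simp: overdue_def h_def)
    have "activation_round h i + T \<le> length h"
      using s activation_round_take[of i s h] by (auto simp: local_round_def active_def)
    then have "(\<Sum>m=1..T. contention p (take (activation_round h i + m) h)) \<le> real k * (\<Sum>m=1..T. p m)"
      using activated_run[of k A \<omega> t] by (intro sum_contention_le assms) (auto simp: h_def)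
    then have "c \<le> weight p T i h"
      unfolding c_def weight_overdue[OF s(2,3,1)] exp_le_cancel_iff using p(1)[of T]
      by (intro mult_left_mono) auto
    then show ?thesis by (simp add: h_def)
  qed
  then have "measure (coins p) {\<omega>. overdue T i (run k A \<omega> t)} \<le>
             measure (coins p) {\<omega> \<in> space (coins p). c \<le> weight p T i (run k A \<omega> t)}"
    using run_Collect_in_sets_coins[of "\<lambda>h. c \<le> weight p T i h" k A t p]
    by (intro finite_measure_mono) auto
  also have "\<dots> \<le> (\<integral>\<omega>. weight p T i (run k A \<omega> t) \<partial>coins p) / c"
    using sets.top[of "coins p"]
    by (intro integral_Markov_inequality_measure[where A = UNIV])
       (auto simp: c_def weight_nonneg expectation_run(1))
  also have "\<dots> \<le> 1 / c"
    using weight_expectation[where p = p, OF assms] by (intro divide_right_mono) (auto simp: c_def)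
  also have "\<dots> = exp (- (p T * (real T - real k * (\<Sum>m=1..T. p m))))"
    unfolding c_def exp_minus by (simp add: inverse_eq_divide)
  finally show ?thesis .
qed

section \<open>Counting attempts\<close>

text \<open>The moment generating function in base 2, as needed for a Chernoff bound. With base 2 it
  is a sum of cylinder probabilities, so independence enters only through
  \<open>measure_cylinder\<close>.\<close>

lemma heads_exponential_moment:
  assumes p: "\<And>m. 0 \<le> p m" "\<And>m. p m \<le> 1" and D: "finite D"
  shows "integrable (coins p) (\<lambda>\<omega>. 2 ^ card {x \<in> D. \<omega> x} :: real)"
    and "(\<integral>\<omega>. 2 ^ card {x \<in> D. \<omega> x} \<partial>coins p) \<le> exp (\<Sum>x\<in>D. p (snd x))"
proof -
  interpret prob_space "coins p" by (rule prob_space_coins)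
  let ?C = "\<lambda>U. {\<omega> :: nat \<times> nat \<Rightarrow> bool. \<forall>x\<in>U. \<omega> x = True}"
  \<comment> \<open>The power of two counts the subsets of \<open>D\<close> on which all coins show heads.\<close>
  have eq: "2 ^ card {x \<in> D. \<omega> x} = (\<Sum>U\<in>Pow D. indicator (?C U) \<omega> :: real)" for \<omega>
  proof -
    have "(\<Sum>U\<in>Pow D. indicator (?C U) \<omega> :: real) = (\<Sum>U\<in>Pow {x \<in> D. \<omega> x}. 1)"
      using D by (intro sum.mono_neutral_cong_right) (auto simp: indicator_def)
    then show ?thesis
      using D by (simp add: card_Pow)
  qed
  have int: "integrable (coins p) (indicator (?C U) :: _ \<Rightarrow> real)" if "U \<in> Pow D" for U
    using that D finite_subset[of U D]
    by (intro integrable_real_indicator cylinder_in_sets_coins) (auto simp: emeasure_eq_measure)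
  show "integrable (coins p) (\<lambda>\<omega>. 2 ^ card {x \<in> D. \<omega> x} :: real)"
    unfolding eq by (intro Bochner_Integration.integrable_sum int)
  have "(\<integral>\<omega>. 2 ^ card {x \<in> D. \<omega> x} \<partial>coins p) = (\<Sum>U\<in>Pow D. measure (coins p) (?C U))"
    unfolding eq by (subst Bochner_Integration.integral_sum) (use int in auto)
  also have "\<dots> = (\<Sum>U\<in>Pow D. (\<Prod>x\<in>U. p (snd x)) * (\<Prod>x\<in>D-U. 1))"
    using D p by (intro sum.cong) (auto simp: measure_cylinder finite_subset simp del: eq_True)
  \<comment> \<open>The sum over subsets is the expansion of this product.\<close>
  also have "\<dots> = (\<Prod>x\<in>D. p (snd x) + 1)"
    using D by (simp only: prod_add)
  also have "\<dots> \<le> (\<Prod>x\<in>D. exp (p (snd x)))"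
    using p by (intro prod_mono) (auto simp: add.commute[of _ 1] intro: add_nonneg_nonneg)
  also have "\<dots> = exp (\<Sum>x\<in>D. p (snd x))"
    using D by (simp add: exp_sum)
  finally show "(\<integral>\<omega>. 2 ^ card {x \<in> D. \<omega> x} \<partial>coins p) \<le> exp (\<Sum>x\<in>D. p (snd x))" .
qed

lemma heads_tail_bound:
  assumes p: "\<And>m. 0 \<le> p m" "\<And>m. p m \<le> 1" and D: "finite D"
  shows "{\<omega>. X < real (card {x \<in> D. \<omega> x})} \<in> sets (coins p)"
    and "measure (coins p) {\<omega>. X < real (card {x \<in> D. \<omega> x})} \<le> exp (\<Sum>x\<in>D. p (snd x)) / 2 powr X"
proof -
  interpret prob_space "coins p" by (rule prob_space_coins)
  note [measurable] = borel_measurable_integrable[OF heads_exponential_moment(1)[where p = p, OF p D]]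
  have eq: "{\<omega>. X < real (card {x \<in> D. \<omega> x})} =
            {\<omega> \<in> space (coins p). 2 powr X < 2 ^ card {x \<in> D. \<omega> x}}"
    by (auto simp flip: powr_realpow)
  show "{\<omega>. X < real (card {x \<in> D. \<omega> x})} \<in> sets (coins p)"
    unfolding eq by measurable
  have "measure (coins p) {\<omega>. X < real (card {x \<in> D. \<omega> x})} \<le>
        measure (coins p) {\<omega> \<in> space (coins p). 2 powr X \<le> 2 ^ card {x \<in> D. \<omega> x}}"
    unfolding eq by (rule finite_measure_mono) (force, measurable)
  also have "\<dots> \<le> (\<integral>\<omega>. 2 ^ card {x \<in> D. \<omega> x} \<partial>coins p) / 2 powr X"
    using heads_exponential_moment(1)[where p = p, OF p D] sets.top[of "coins p"]
    by (intro integral_Markov_inequality_measure[where A = UNIV]) auto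
  also have "\<dots> \<le> exp (\<Sum>x\<in>D. p (snd x)) / 2 powr X"
    by (intro divide_right_mono heads_exponential_moment(2) assms) auto
  finally show "measure (coins p) {\<omega>. X < real (card {x \<in> D. \<omega> x})} \<le>
    exp (\<Sum>x\<in>D. p (snd x)) / 2 powr X" .
qed

section \<open>From finite histories to the infinite execution\<close>

definition recorded_attempts :: "history \<Rightarrow> (nat \<times> nat) set" where
  "recorded_attempts h = {(s, j). s < length h \<and> j \<in> snd (h ! s)}"

lemma recorded_attempts_run:
  "recorded_attempts (run k A \<omega> t) = {x \<in> attempts k A \<omega>. fst x < t}"
  by (auto simp: recorded_attempts_def attempts_def transmitters_def nth_run)

lemma finite_recorded_attempts: "finite (recorded_attempts (run k A \<omega> t))"
proof (rule finite_subset)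
  show "recorded_attempts (run k A \<omega> t) \<subseteq> {..<t} \<times> {..<k}"
    using subsetD[OF active_run] by (auto simp: recorded_attempts_def nth_run next_round_def)
qed simp

text \<open>Expresses the event about the infinite execution as a countable intersection of events
  about finite histories. Finiteness has to be derived too, since \<open>card\<close> of an infinite
  set is 0: an infinite set would contain a finite subset with more than \<open>X\<close> elements,
  and finitely many rounds already record it.\<close>

lemma attempts_le_iff:
  "finite (attempts k A \<omega>) \<and> real (card (attempts k A \<omega>)) \<le> X \<longleftrightarrow>
   (\<forall>t. real (card (recorded_attempts (run k A \<omega> t))) \<le> X)"
proof (intro iffI allI)
  fix t assume fin: "finite (attempts k A \<omega>) \<and> real (card (attempts k A \<omega>)) \<le> X"
  then have "card (recorded_attempts (run k A \<omega> t)) \<le> card (attempts k A \<omega>)"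
    by (intro card_mono) (auto simp: recorded_attempts_run)
  with fin show "real (card (recorded_attempts (run k A \<omega> t))) \<le> X"
    by linarith
next
  assume bound: "\<forall>t. real (card (recorded_attempts (run k A \<omega> t))) \<le> X"
  have card_le: "card F \<le> nat \<lfloor>X\<rfloor>" if F: "finite F" "F \<subseteq> attempts k A \<omega>" for F
  proof -
    obtain t where "\<forall>s\<in>fst ` F. s < t"
      using F(1) finite_nat_set_iff_bounded[of "fst ` F"] by auto
    then have "card F \<le> card (recorded_attempts (run k A \<omega> t))"
      using F(2) by (intro card_mono finite_recorded_attempts) (auto simp: recorded_attempts_run)
    then have "real (card F) \<le> X"
      using bound[rule_format, of t] by linarith
    then show ?thesis
      by (rule le_nat_floor)
  qed
  have fin: "finite (attempts k A \<omega>)"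
  proof (rule ccontr)
    assume "infinite (attempts k A \<omega>)"
    then obtain F where "finite F" "card F = Suc (nat \<lfloor>X\<rfloor>)" "F \<subseteq> attempts k A \<omega>"
      using infinite_arbitrarily_large by metis
    with card_le[of F] show False by simp
  qed
  have "0 \<le> X"
    using bound[rule_format, of 0] by (rule order_trans[rotated]) simp
  moreover have "real (card (attempts k A \<omega>)) \<le> real (nat \<lfloor>X\<rfloor>)"
    using card_le[OF fin] by simp
  ultimately show "finite (attempts k A \<omega>) \<and> real (card (attempts k A \<omega>)) \<le> X"
    using fin of_nat_floor[of X] by linarith
qed

text \<open>Each transmission is charged to the coin that caused it, which shows heads. The charge
  is injective because the activation round plus the local round recovers the global round.\<close>

lemma card_recorded_attempts_le:
  assumes "\<And>i. i < k \<Longrightarrow> \<not> overdue T i (run k A \<omega> t)"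
  shows "card (recorded_attempts (run k A \<omega> t)) \<le> card {x \<in> {..<k} \<times> {1..T}. \<omega> x}"
proof (rule card_inj_on_le)
  let ?h = "run k A \<omega> t"
  have rec: "j \<in> active (run k A \<omega> s) \<and> \<omega> (j, local_round (run k A \<omega> s) j) \<and> s < t"
    if "(s, j) \<in> recorded_attempts ?h" for s j
    using that by (auto simp: recorded_attempts_def nth_run next_round_def)
  have clock: "s = local_round (run k A \<omega> s) j + activation_round ?h j"
    if "(s, j) \<in> recorded_attempts ?h" for s j
    using rec[OF that] activation_round_take[of j s ?h] local_round_pos[of j "run k A \<omega> s"]
    by (auto simp: take_run active_def local_round_def)
  show "inj_on (\<lambda>(s, j). (j, local_round (run k A \<omega> s) j)) (recorded_attempts ?h)"
  proof (rule inj_onI, clarsimp)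
    fix s s' j
    assume "(s, j) \<in> recorded_attempts ?h" "(s', j) \<in> recorded_attempts ?h"
      and "local_round (run k A \<omega> s) j = local_round (run k A \<omega> s') j"
    then show "s = s'"
      using clock[of s j] clock[of s' j] by linarith
  qed
  have "(j, local_round (run k A \<omega> s) j) \<in> {x \<in> {..<k} \<times> {1..T}. \<omega> x}"
    if sj: "(s, j) \<in> recorded_attempts ?h" for s j
  proof -
    have j: "j < k"
      using rec[OF sj] active_run[of k A \<omega> s] by auto
    have "local_round (run k A \<omega> s) j \<le> T"
      using assms[OF j] rec[OF sj] unfolding overdue_def
      by (metis length_run less_imp_le not_le take_run)
    then show ?thesis
      using j rec[OF sj] local_round_pos[of j "run k A \<omega> s"] by auto
  qed
  then show "(\<lambda>(s, j). (j, local_round (run k A \<omega> s) j)) ` recorded_attempts ?h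
        \<subseteq> {x \<in> {..<k} \<times> {1..T}. \<omega> x}"
    by auto
qed simp

text \<open>Up to any round \<open>t\<close>, too many transmissions require too many heads among
  the first \<open>T\<close> coins of each station, or some overdue station. The union bound does
  not depend on \<open>t\<close>, so it survives the limit by continuity from above.\<close>

lemma attempts_probability:
  assumes p: "\<And>m. 0 \<le> p m" "\<And>m. p m \<le> 1"
    and anti: "\<And>m n. 0 < m \<Longrightarrow> m \<le> n \<Longrightarrow> p n \<le> p m"
  defines "L \<equiv> \<lambda>T. \<Sum>m=1..T. p m"
  shows "measure (coins p) {\<omega>. finite (attempts k A \<omega>) \<and> real (card (attempts k A \<omega>)) \<le> X} \<ge>
         1 - real k * exp (- (p T * (real T - real k * L T))) - exp (real k * L T) / 2 powr X"
    (is "?bound \<le> _")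
proof -
  interpret prob_space "coins p" by (rule prob_space_coins)
  define B where "B t = {\<omega>. real (card (recorded_attempts (run k A \<omega> t))) \<le> X}" for t
  define H where "H = {\<omega>. X < real (card {x \<in> {..<k} \<times> {1..T}. \<omega> x})}"
  define V where "V t i = {\<omega>. overdue T i (run k A \<omega> t)}" for t i
  have B: "B t \<in> events" and V: "V t i \<in> events" and H: "H \<in> events" for t i
    unfolding B_def V_def H_def using p
    by (simp_all add: run_Collect_in_sets_coins[where P = "\<lambda>h. real (card (recorded_attempts h)) \<le> X"]
      run_Collect_in_sets_coins heads_tail_bound(1))
  have "decseq B"
    unfolding B_def decseq_def
    by (auto simp: recorded_attempts_run elim!: order_trans[rotated]
        intro!: card_mono finite_recorded_attempts[unfolded recorded_attempts_run])
  then have lim: "(\<lambda>t. prob (B t)) \<longlonglongrightarrow> prob (\<Inter>t. B t)"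
    using B by (intro finite_Lim_measure_decseq) auto
  have "?bound \<le> prob (B t)" for t
  proof -
    have "- B t \<subseteq> H \<union> (\<Union>i<k. V t i)"
    proof
      fix \<omega> assume "\<omega> \<in> - B t"
      then show "\<omega> \<in> H \<union> (\<Union>i<k. V t i)"
        using card_recorded_attempts_le[of k T A \<omega> t] by (fastforce simp: B_def H_def V_def)
    qed
    then have "prob (- B t) \<le> prob (H \<union> (\<Union>i<k. V t i))"
      using V H by (intro finite_measure_mono) auto
    also have "\<dots> \<le> prob H + prob (\<Union>i<k. V t i)"
      using V H by (intro measure_Un_le) auto
    also have "prob (\<Union>i<k. V t i) \<le> (\<Sum>i<k. prob (V t i))"
      using V by (intro measure_UNION_le) auto
    also have "\<dots> \<le> (\<Sum>i<k. exp (- (p T * (real T - real k * L T))))"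
      unfolding V_def L_def by (intro sum_mono overdue_probability assms)
    also have "prob H \<le> exp (real k * L T) / 2 powr X"
    proof -
      have "(\<Sum>x\<in>{..<k} \<times> {1..T}. p (snd x)) = real k * L T"
        using sum.cartesian_product[of "\<lambda>_. p" "{1..T}" "{..<k}"] by (simp add: L_def case_prod_unfold)
      then show ?thesis
        using heads_tail_bound(2)[where p = p, OF p, where D = "{..<k} \<times> {1..T}" and X = X] by (simp add: H_def)
    qed
    finally have "prob (- B t) \<le> exp (real k * L T) / 2 powr X + real k * exp (- (p T * (real T - real k * L T)))"
      by simp
    moreover have "prob (- B t) = 1 - prob (B t)"
      using prob_compl[OF B[of t]] by (simp add: Compl_eq_Diff_UNIV)
    ultimately show ?thesis by linarith
  qed
  then have "?bound \<le> prob (\<Inter>t. B t)"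
    by (intro LIMSEQ_le_const[OF lim]) auto
  also have "(\<Inter>t. B t) = {\<omega>. finite (attempts k A \<omega>) \<and> real (card (attempts k A \<omega>)) \<le> X}"
    unfolding attempts_le_iff by (auto simp: B_def)
  finally show ?thesis .
qed

section \<open>The probabilities of SublinearDecrease\<close>

lemma sublinear_decrease_nonneg: "0 \<le> sublinear_decrease b m"
  by (auto simp: sublinear_decrease_def Let_def)

lemma sublinear_decrease_le_1: "sublinear_decrease b m \<le> 1"
  using ln_bound[of "real (3 + (m - 1) div b)"] by (auto simp: sublinear_decrease_def Let_def)

text \<open>The function \<open>ln x / x\<close> decreases only from \<open>exp 1\<close> on; the
  protocol starts at \<open>j = 3\<close>, just beyond it.\<close>

lemma sublinear_decrease_antimono:
  assumes "m \<le> n"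
  shows "sublinear_decrease b n \<le> sublinear_decrease b m"
proof -
  have "3 \<le> 3 + (m - 1) div b" "3 + (m - 1) div b \<le> 3 + (n - 1) div b"
    using assms by (auto intro: div_le_mono)
  then have "exp 1 \<le> real (3 + (m - 1) div b)" "real (3 + (m - 1) div b) \<le> real (3 + (n - 1) div b)"
    using exp_le by linarith+
  then show ?thesis
    unfolding sublinear_decrease_def Let_def by (rule ln_x_over_x_mono)
qed

lemma sum_sublinear_decrease:
  assumes "0 < b"
  shows "(\<Sum>m=1..n * b. sublinear_decrease b m) = real b * (\<Sum>j<n. ln (real (3 + j)) / real (3 + j))"
proof -
  have "(\<Sum>m=1..n * b. sublinear_decrease b m) =
        (\<Sum>m<n * b. ln (real (3 + m div b)) / real (3 + m div b))"
    unfolding One_nat_def sum.atLeast1_atMost_eq by (simp add: sublinear_decrease_def Let_def)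
  also have "\<dots> = (\<Sum>j<n. \<Sum>m=j * b..<j * b + b. ln (real (3 + m div b)) / real (3 + m div b))"
    by (rule sum.nat_group[symmetric])
  also have "\<dots> = (\<Sum>j<n. \<Sum>m=j * b..<j * b + b. ln (real (3 + j)) / real (3 + j))"
  proof (intro sum.cong refl)
    fix j m assume "m \<in> {j * b..<j * b + b}"
    then have "m div b = j"
      using assms by (intro div_nat_eqI) (auto simp: mult.commute)
    then show "ln (real (3 + m div b)) / real (3 + m div b) = ln (real (3 + j)) / real (3 + j)"
      by simp
  qed
  finally show ?thesis
    by (simp add: sum_distrib_left)
qed

section \<open>Sums of \<open>ln j / j\<close> and the horizon\<close>

lemma ln_le_2_sqrt:
  assumes "0 < x"
  shows "ln x \<le> 2 * sqrt x"
  using ln_bound[of "sqrt x"] assms ln_sqrt[of x] by simp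

text \<open>A crude bound by telescoping, used to fix a horizon with explicit constants: each term
  is at most \<open>2 / y\<close>, and \<open>4 * (y - x)\<close> is at least that because
  \<open>(y - x) * (y + x) = 1\<close>.\<close>

lemma sum_ln_over_le_sqrt: "(\<Sum>j<n. ln (real (3 + j)) / real (3 + j)) \<le> 4 * sqrt (real n)"
proof (induction n)
  case (Suc n)
  define x where "x = sqrt (real n)"
  define y where "y = sqrt (real (Suc n))"
  have xy: "0 \<le> x" "x \<le> y" "1 \<le> y" "y\<^sup>2 - x\<^sup>2 = 1" and y: "y \<le> sqrt (real (3 + n))"
    by (auto simp: x_def y_def)
  have "ln (real (3 + n)) / real (3 + n) \<le> 2 * sqrt (real (3 + n)) / real (3 + n)"
    by (intro divide_right_mono ln_le_2_sqrt) auto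
  also have "\<dots> = 2 / sqrt (real (3 + n))"
    by (simp add: field_simps)
  also have "\<dots> \<le> 2 / y"
    using xy y by (intro divide_left_mono) auto
  also have "\<dots> \<le> 4 * (y - x)"
  proof -
    have "2 * 1 = 2 * ((y - x) * (y + x))"
      using xy(4) by (simp add: power2_eq_square algebra_simps)
    also have "\<dots> \<le> 2 * ((y - x) * (2 * y))"
      using xy by (intro mult_left_mono) auto
    finally show ?thesis
      using xy by (simp add: field_simps)
  qed
  finally show ?case
    using Suc by (simp add: x_def y_def)
qed simp

text \<open>The sharper bound, responsible for the squared logarithm in the result. Squares of
  logarithms telescope: \<open>(y + x) * (y - x)\<close> is at least
  \<open>y / (n + 3)\<close>.\<close>

lemma sum_ln_over_le_ln_sq: "(\<Sum>j<n. ln (real (3 + j)) / real (3 + j)) \<le> (ln (real (n + 2)))\<^sup>2"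
proof (induction n)
  case (Suc n)
  define x where "x = ln (real (n + 2))"
  define y where "y = ln (real (n + 3))"
  have xy: "0 \<le> x" "x \<le> y"
    by (auto simp: x_def y_def)
  have "1 / real (n + 3) \<le> y - x"
    using ln_le_minus_one[of "real (n + 2) / real (n + 3)"]
    by (simp add: x_def y_def ln_div field_simps)
  then have "y * (1 / real (n + 3)) \<le> (y + x) * (y - x)"
    using xy by (intro mult_mono) auto
  then have "y / real (n + 3) \<le> y\<^sup>2 - x\<^sup>2"
    by (simp add: power2_eq_square algebra_simps)
  then show ?case
    using Suc by (simp add: x_def y_def add.commute)
qed simp

text \<open>The constant 64 makes the square root of the number \<open>n\<close> of blocks equal to
  \<open>8 * k\<close>, so the crude bound limits the total contention to
  \<open>32 * b * k^2\<close>, which is \<open>T / 2\<close>.\<close>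

lemma overdue_exponent:
  fixes b k :: nat
  assumes b: "0 < b" and k: "2 \<le> k"
  defines "T \<equiv> 64 * k\<^sup>2 * b"
  shows "sublinear_decrease b T * (real T - real k * (\<Sum>m=1..T. sublinear_decrease b m))
         \<ge> real b / 4 * ln (real k)"
proof -
  define n where "n = 64 * k\<^sup>2"
  have "2 * k \<le> k\<^sup>2"
    using k by (simp add: power2_eq_square)
  then have n: "2 \<le> n" "k \<le> n + 2"
    using k by (auto simp: n_def)
  \<comment> \<open>Round \<open>T\<close> is the last one of the \<open>n\<close>-th block, whose
    index counted from 0 is \<open>n - 1\<close>; hence \<open>j = n + 2\<close> there.\<close>
  have "T - 1 = b - 1 + (n - 1) * b"
    using b n by (cases n; cases b) (auto simp: T_def n_def[symmetric])
  then have "(T - 1) div b = n - 1"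
    using b by (simp only: div_mult_self1) simp
  then have pT: "sublinear_decrease b T = ln (real (n + 2)) / real (n + 2)"
    using n by (simp add: sublinear_decrease_def Let_def)
  have "sqrt (real n) = 8 * real k"
    by (simp add: n_def real_sqrt_mult)
  then have "(\<Sum>m=1..T. sublinear_decrease b m) \<le> real b * (32 * real k)"
    using sum_sublinear_decrease[OF b, of n] sum_ln_over_le_sqrt[of n]
    by (simp add: T_def n_def mult_left_mono)
  then have "real k * (\<Sum>m=1..T. sublinear_decrease b m) \<le> real k * (real b * (32 * real k))"
    by (intro mult_left_mono) auto
  also have "\<dots> = real T / 2"
    by (simp add: T_def power2_eq_square)
  finally have "real T / 2 \<le> real T - real k * (\<Sum>m=1..T. sublinear_decrease b m)"
    by simp
  then have "sublinear_decrease b T * (real T / 2) \<le>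
    sublinear_decrease b T * (real T - real k * (\<Sum>m=1..T. sublinear_decrease b m))"
    by (intro mult_left_mono sublinear_decrease_nonneg)
  moreover have "real b / 4 * ln (real k) \<le> sublinear_decrease b T * (real T / 2)"
  proof -
    have "real b / 4 * ln (real k) \<le> real b / 4 * ln (real (n + 2))"
      using k n by (intro mult_left_mono) auto
    also have "\<dots> \<le> (real b / 4 * ln (real (n + 2))) * (2 * real n / real (n + 2))"
      using mult_left_mono[of 1 "2 * real n / real (n + 2)" "real b / 4 * ln (real (n + 2))"] n
      by simp
    also have "\<dots> = sublinear_decrease b T * (real T / 2)"
      unfolding pT by (simp add: T_def n_def)
    finally show ?thesis .
  qed
  ultimately show ?thesis by linarith
qed

text \<open>Here \<open>n + 2\<close> is at most \<open>128 * k^2\<close>, hence at most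
  \<open>k ^ 9\<close> since \<open>k\<close> is at least 2; squaring the resulting factor 9 gives
  81.\<close>

lemma sum_sublinear_decrease_le:
  fixes b k :: nat
  assumes b: "0 < b" and k: "2 \<le> k"
  shows "(\<Sum>m=1..64 * k\<^sup>2 * b. sublinear_decrease b m) \<le> 81 * real b * (log 2 (real k))\<^sup>2"
proof -
  define n where "n = 64 * k\<^sup>2"
  have "2 * k \<le> k\<^sup>2"
    using k by (simp add: power2_eq_square)
  then have "n + 2 \<le> 2 ^ 7 * k\<^sup>2"
    using k by (simp add: n_def)
  also have "\<dots> \<le> k ^ 7 * k\<^sup>2"
    using k by (intro mult_right_mono power_mono) auto
  finally have "real (n + 2) \<le> real (k ^ 9)"
    by (simp only: of_nat_le_iff power_add[symmetric]) simp
  then have "ln (real (n + 2)) \<le> ln (real (k ^ 9))"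
    using k by (subst ln_le_cancel_iff) auto
  also have "\<dots> = 9 * ln (real k)"
    using k by (simp add: ln_realpow)
  also have "ln (real k) \<le> log 2 (real k)"
    using k ln_2_less_1 by (simp add: log_def field_simps mult_left_le)
  finally have "(ln (real (n + 2)))\<^sup>2 \<le> (9 * log 2 (real k))\<^sup>2"
    by (intro power_mono) auto
  then have "(\<Sum>j<n. ln (real (3 + j)) / real (3 + j)) \<le> 81 * (log 2 (real k))\<^sup>2"
    using sum_ln_over_le_ln_sq[of n] by (simp add: power_mult_distrib)
  then have "real b * (\<Sum>j<n. ln (real (3 + j)) / real (3 + j)) \<le> real b * (81 * (log 2 (real k))\<^sup>2)"
    by (intro mult_left_mono) auto
  then show ?thesis
    using sum_sublinear_decrease[OF b, of n] by (simp add: n_def)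
qed

section \<open>Choice of the constants\<close>

theorem theorem5p3:
  "\<forall>\<eta>::real. \<eta> > 0 \<longrightarrow>
     (\<exists>b0::nat. \<forall>b\<ge>b0. \<exists>C::real. \<forall>k\<ge>2. \<forall>A::adversary.
        activates_all k (sublinear_decrease b) A \<longrightarrow>
        measure (coins (sublinear_decrease b))
          {\<omega> \<in> space (coins (sublinear_decrease b)).
             finite (attempts k A \<omega>) \<and>
             real (card (attempts k A \<omega>)) \<le> C * real k * (log 2 (real k))\<^sup>2}
        \<ge> 1 - 1 / real k powr \<eta>)"
proof -
  \<comment> \<open>Each kind of failure is allotted half of \<open>k powr (-\<eta>)\<close>. For
    overdue stations \<open>b / 4\<close> is at least \<open>\<eta> + 2\<close>: one unit pays for
    the union bound over \<open>k\<close> stations, the other for the factor 1/2. In the Chernoff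
    bound \<open>162 = 2 * 81\<close> absorbs the exponential of the mean, and the surplus
    \<open>1 + \<eta>\<close> supplies the decay.\<close>
  have "1 - 1 / real k powr \<eta> \<le> measure (coins (sublinear_decrease b))
          {\<omega>. finite (attempts k A \<omega>) \<and>
             real (card (attempts k A \<omega>)) \<le> (162 * real b + 1 + \<eta>) * real k * (log 2 (real k))\<^sup>2}"
    if \<eta>: "0 < \<eta>" and b0: "4 * (\<eta> + 2) \<le> real b" and k: "2 \<le> k" for \<eta> :: real and b k :: nat and A
  proof -
    define T where "T = 64 * k\<^sup>2 * b"
    define l where "l = log 2 (real k)"
    define X where "X = (162 * real b + 1 + \<eta>) * real k * l\<^sup>2"
    let ?p = "sublinear_decrease b"
    have b: "0 < b"
      using \<eta> b0 by (cases b) auto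
    have l: "1 \<le> l"
      using k by (simp add: l_def)
    have k_eq: "real k = 2 powr l"
      using k by (simp add: l_def)
    have half: "real k powr (-\<eta>) / 2 = 2 powr (- (\<eta> * l) - 1)"
      by (simp add: k_eq powr_powr powr_diff mult.commute)
    have "real k * exp (- (?p T * (real T - real k * (\<Sum>m=1..T. ?p m)))) \<le>
          real k * exp (- ((\<eta> + 2) * ln (real k)))"
    proof (intro mult_left_mono)
      have "(\<eta> + 2) * ln (real k) \<le> real b / 4 * ln (real k)"
        using b0 k by (intro mult_right_mono) auto
      also note overdue_exponent[OF b k, folded T_def]
      finally show "exp (- (?p T * (real T - real k * (\<Sum>m=1..T. ?p m)))) \<le> exp (- ((\<eta> + 2) * ln (real k)))"
        by simp
    qed simp
    also have "\<dots> = 2 powr l * (2 powr l) powr (- (\<eta> + 2))"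
      unfolding k_eq[symmetric] using k by (simp add: powr_def algebra_simps)
    also have "\<dots> = 2 powr (l + l * (- (\<eta> + 2)))"
      by (simp only: powr_powr powr_add)
    also have "\<dots> \<le> 2 powr (- (\<eta> * l) - 1)"
      using l by (intro powr_mono) (auto simp: algebra_simps)
    finally have late: "real k * exp (- (?p T * (real T - real k * (\<Sum>m=1..T. ?p m)))) \<le> real k powr (-\<eta>) / 2"
      unfolding half .
    have "exp (real k * (\<Sum>m=1..T. ?p m)) / 2 powr X \<le> 2 powr (162 * real b * real k * l\<^sup>2) / 2 powr X"
    proof (intro divide_right_mono)
      have "real k * (\<Sum>m=1..T. ?p m) \<le> real k * (81 * real b * l\<^sup>2)"
        unfolding T_def l_def using k by (intro mult_left_mono sum_sublinear_decrease_le b) auto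
      also have "\<dots> = (162 * real b * real k * l\<^sup>2) * (1 / 2)"
        by simp
      \<comment> \<open>Passing from base \<open>exp 1\<close> to base 2 costs at most a factor 2 in
        the exponent, since \<open>ln 2\<close> exceeds 1/2.\<close>
      also have "\<dots> \<le> (162 * real b * real k * l\<^sup>2) * ln 2"
        using ln2_ge_two_thirds by (intro mult_left_mono) auto
      finally show "exp (real k * (\<Sum>m=1..T. ?p m)) \<le> 2 powr (162 * real b * real k * l\<^sup>2)"
        by (simp add: powr_def)
    qed simp
    also have "\<dots> = 2 powr (- ((1 + \<eta>) * real k * l\<^sup>2))"
      by (simp add: powr_diff[symmetric] X_def algebra_simps)
    also have "\<dots> \<le> 2 powr (- (\<eta> * l) - 1)"
    proof -
      have "1 * l \<le> real k * l\<^sup>2"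
        using k l by (intro mult_mono) (auto simp: power2_eq_square)
      then have "(1 + \<eta>) * l \<le> (1 + \<eta>) * (real k * l\<^sup>2)"
        using \<eta> by (intro mult_left_mono) auto
      then show ?thesis
        using l by (intro powr_mono) (auto simp: algebra_simps)
    qed
    finally have many: "exp (real k * (\<Sum>m=1..T. ?p m)) / 2 powr X \<le> real k powr (-\<eta>) / 2"
      unfolding half .
    have "1 - 1 / real k powr \<eta> = 1 - real k powr (-\<eta>) / 2 - real k powr (-\<eta>) / 2"
      by (simp add: powr_minus_divide)
    also have "\<dots> \<le> 1 - real k * exp (- (?p T * (real T - real k * (\<Sum>m=1..T. ?p m))))
        - exp (real k * (\<Sum>m=1..T. ?p m)) / 2 powr X"
      using late many by linarith
    also have "\<dots> \<le> measure (coins ?p) {\<omega>. finite (attempts k A \<omega>) \<and> real (card (attempts k A \<omega>)) \<le> X}"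
      by (rule attempts_probability)
         (simp_all add: sublinear_decrease_nonneg sublinear_decrease_le_1 sublinear_decrease_antimono)
    finally show ?thesis
      by (simp add: X_def l_def)
  qed
  note bound = this
  show ?thesis
  proof (intro allI impI)
    fix \<eta> :: real assume \<eta>: "0 < \<eta>"
    show "\<exists>b0::nat. \<forall>b\<ge>b0. \<exists>C::real. \<forall>k\<ge>2. \<forall>A::adversary.
        activates_all k (sublinear_decrease b) A \<longrightarrow>
        measure (coins (sublinear_decrease b))
          {\<omega> \<in> space (coins (sublinear_decrease b)).
             finite (attempts k A \<omega>) \<and>
             real (card (attempts k A \<omega>)) \<le> C * real k * (log 2 (real k))\<^sup>2}
        \<ge> 1 - 1 / real k powr \<eta>"
    proof (intro exI[of _ "nat \<lceil>4 * (\<eta> + 2)\<rceil>"] allI impI)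
      fix b assume "nat \<lceil>4 * (\<eta> + 2)\<rceil> \<le> b"
      then have "4 * (\<eta> + 2) \<le> real b"
        by linarith
      then show "\<exists>C::real. \<forall>k\<ge>2. \<forall>A::adversary.
        activates_all k (sublinear_decrease b) A \<longrightarrow>
        measure (coins (sublinear_decrease b))
          {\<omega> \<in> space (coins (sublinear_decrease b)).
             finite (attempts k A \<omega>) \<and>
             real (card (attempts k A \<omega>)) \<le> C * real k * (log 2 (real k))\<^sup>2}
        \<ge> 1 - 1 / real k powr \<eta>"
        using bound[OF \<eta>] by (intro exI[of _ "162 * real b + 1 + \<eta>"]) simp
    qed
  qed
qed

end
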